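(* Let $\sigma,\tau>0$ and $(\bar x^0,\bar y^0)\in X\times Y$. If $L$ possesses a saddle-point, then the sequence $\{(x^k,y^k,\bar x^k,\bar y^k)\}_{k\ge1}$ generated by the Douglas--Rachford iteration (DR) converges weakly to some $(x^*,y^*,\bar x^*,\bar y^* )$ for which $(x^*,y^* )$ is a saddle-point of $L$ and $(\bar x^*,\bar y^* )=(x^*-\sigma K^*y^*,\;y^*+\tau Kx^* )$.
   Context: $X,Y$ are real Hilbert spaces, $K:X\to Y$ is linear and continuous with adjoint $K^*$, and $F:X\to(-\infty,\infty]$, $G:Y\to(-\infty,\infty]$ are proper, convex and lower semi-continuous. $L(x,y)=\langle Kx,y\rangle+F(x)-G(y)$ on $\operatorname{dom}F\times\operatorname{dom}G$; a saddle-point (solution of $\min_{x}\max_{y}L(x,y)$) is $(x^*,y^* )\in\operatorname{dom}F\times\operatorname{dom}G$ with $L(x^*,y)\le L(x^*,y^* )\le L(x,y^* )$ for all $(x,y)\in\operatorname{dom}F\times\operatorname{dom}G$. Iteration (DR), for $k\ge0$: $x^{k+1}=(\mathrm{id}+\sigma\partial F)^{-1}(\bar x^k)$, $y^{k+1}=(\mathrm{id}+\tau\partial G)^{-1}(\bar y^k)$, $b^{k+1}=(2x^{k+1}-\bar x^k)-\sigma K^*(2y^{k+1}-\bar y^k)$, $d^{k+1}=(\mathrm{id}+\sigma\tau K^*K)^{-1}b^{k+1}$, $\bar x^{k+1}=\bar x^k-x^{k+1}+d^{k+1}$, $\bar y^{k+1}=y^{k+1}+\tau Kd^{k+1}$.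 Equivalently, $\bar x^{k+1}=x^{k+1}-\sigma K^*(y^{k+1}+\bar y^{k+1}-\bar y^k)$ and $\bar y^{k+1}=y^{k+1}+\tau K(x^{k+1}+\bar x^{k+1}-\bar x^k)$. Here $(\mathrm{id}+\sigma\partial F)^{-1}$ denotes the resolvent (proximal map) of the subdifferential. *)

theory Defs
  imports "HOL-Analysis.Analysis"
begin

definition eff_dom :: "('a \<Rightarrow> ereal) \<Rightarrow> 'a set" where
  "eff_dom F = {x. F x < \<infinity>}"

definition proper_fun :: "('a \<Rightarrow> ereal) \<Rightarrow> bool" where
  "proper_fun F \<longleftrightarrow> (\<forall>x. F x \<noteq> -\<infinity>) \<and> eff_dom F \<noteq> {}"

(* Only 0 < t < 1 is needed; this keeps the products 0 * \<infinity> out of the inequality. *)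
definition convex_fun :: "('a::real_vector \<Rightarrow> ereal) \<Rightarrow> bool" where
  "convex_fun F \<longleftrightarrow>
     (\<forall>x y. \<forall>t::real. 0 < t \<longrightarrow> t < 1 \<longrightarrow>
        F ((1 - t) *\<^sub>R x + t *\<^sub>R y) \<le> ereal (1 - t) * F x + ereal t * F y)"

definition lsc_fun :: "('a::topological_space \<Rightarrow> ereal) \<Rightarrow> bool" where
  "lsc_fun F \<longleftrightarrow> (\<forall>x. F x \<le> Liminf (at x) F)"

definition subdifferential :: "('a::real_inner \<Rightarrow> ereal) \<Rightarrow> 'a \<Rightarrow> 'a set" where
  "subdifferential F x = {g. x \<in> eff_dom F \<and> (\<forall>z. F x + ereal (g \<bullet> (z - x)) \<le> F z)}"

(* The value at u of the inverse of id + r A, for a set-valued operator A.  For r > 0 and A the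
   subdifferential of a proper, convex, lower semi-continuous function on a Hilbert space, the
   inclusion u \<in> x + r A x has exactly one solution x for every u. *)
definition resolvent :: "real \<Rightarrow> ('a::real_vector \<Rightarrow> 'a set) \<Rightarrow> 'a \<Rightarrow> 'a" where
  "resolvent r A u = (THE x. \<exists>g\<in>A x. u = x + r *\<^sub>R g)"

(* On eff_dom F \<times> eff_dom G, for proper F and G, all terms are finite. *)
definition lagrangian ::
  "('a \<Rightarrow> 'b::real_inner) \<Rightarrow> ('a \<Rightarrow> ereal) \<Rightarrow> ('b \<Rightarrow> ereal) \<Rightarrow> 'a \<Rightarrow> 'b \<Rightarrow> ereal" where
  "lagrangian K F G x y = ereal (K x \<bullet> y) + F x - G y"

definition saddle_point ::
  "('a \<Rightarrow> 'b::real_inner) \<Rightarrow> ('a \<Rightarrow> ereal) \<Rightarrow> ('b \<Rightarrow> ereal) \<Rightarrow> 'a \<Rightarrow> 'b \<Rightarrow> bool" where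
  "saddle_point K F G xs ys \<longleftrightarrow>
     xs \<in> eff_dom F \<and> ys \<in> eff_dom G \<and>
     (\<forall>x\<in>eff_dom F. \<forall>y\<in>eff_dom G.
        lagrangian K F G xs y \<le> lagrangian K F G xs ys \<and>
        lagrangian K F G xs ys \<le> lagrangian K F G x ys)"

(* x 0, y 0, b 0 and d 0 are unconstrained: the iteration starts from xbar 0 and ybar 0. *)
definition DR_iteration ::
  "('a::real_inner \<Rightarrow> 'b::real_inner) \<Rightarrow> ('a \<Rightarrow> ereal) \<Rightarrow> ('b \<Rightarrow> ereal) \<Rightarrow> real \<Rightarrow> real \<Rightarrow>
   (nat \<Rightarrow> 'a) \<Rightarrow> (nat \<Rightarrow> 'b) \<Rightarrow> (nat \<Rightarrow> 'a) \<Rightarrow> (nat \<Rightarrow> 'b) \<Rightarrow> (nat \<Rightarrow> 'a) \<Rightarrow> (nat \<Rightarrow> 'a) \<Rightarrow> bool" where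
  "DR_iteration K F G \<sigma> \<tau> x y xbar ybar b d \<longleftrightarrow>
     (\<forall>k.
        x (Suc k) = resolvent \<sigma> (subdifferential F) (xbar k) \<and>
        y (Suc k) = resolvent \<tau> (subdifferential G) (ybar k) \<and>
        b (Suc k) = (2 *\<^sub>R x (Suc k) - xbar k) - \<sigma> *\<^sub>R adjoint K (2 *\<^sub>R y (Suc k) - ybar k) \<and>
        d (Suc k) = inv (\<lambda>z. z + (\<sigma> * \<tau>) *\<^sub>R adjoint K (K z)) (b (Suc k)) \<and>
        xbar (Suc k) = xbar k - x (Suc k) + d (Suc k) \<and>
        ybar (Suc k) = y (Suc k) + \<tau> *\<^sub>R K (d (Suc k)))"

definition weakly_converges_to :: "(nat \<Rightarrow> 'a::real_normed_vector) \<Rightarrow> 'a \<Rightarrow> bool" where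
  "weakly_converges_to u l \<longleftrightarrow>
     (\<forall>f :: 'a \<Rightarrow> real. bounded_linear f \<longrightarrow> (\<lambda>n. f (u n)) \<longlonglongrightarrow> f l)"

end

theory Submission
  imports Defs
begin

text \<open>
  Saddle points of the Lagrangian are the zeros \<open>(x, y)\<close> of \<open>B + A\<close> on the product space, where
  \<open>B = \<partial>F \<times> \<partial>G\<close> is monotone and \<open>A (x, y) = (K\<^sup>* y, - K x)\<close> is skew-symmetric
  (\<open>saddle_point_iff_subgradients\<close>). In a suitably scaled inner product, one step of the iteration is
  a Douglas--Rachford step for this sum: apply the resolvent of \<open>B\<close>, reflect, apply the resolvent of
  \<open>A\<close>, and add the difference of the two results to the governing point. The linear solve with
  \<open>id + \<sigma>\<tau>K\<^sup>*K\<close> is the resolvent of \<open>A\<close> after elimination of its dual component.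

  The step is firmly nonexpansive (\<open>fejer\<close>). Hence the distance of the governing sequence
  \<open>(xbar, ybar)\<close> to any fixed point decreases, the sequence is bounded, and successive differences
  tend to zero strongly. Bounded sequences have weak cluster points (\<open>weak_cluster_point_exists\<close>), so it
  remains to show that each weak cluster point of the iterates together with the governing sequence
  is an equilibrium (\<open>weak_cluster_points_are_equilibria\<close>) and that there is only one
  (\<open>weak_cluster_point_unique\<close>, Opial's argument). The first is the delicate point, since resolvents
  are not weakly continuous; here it holds because \<open>A\<close> is linear and skew. An equilibrium is a zero
  \<open>p\<close> of \<open>B + A\<close> together with the governing point \<open>q = p - A p\<close>, which in the original variables is
  the stated relation between the limits.

  The Hilbert space facts needed for this all come from one source, the existence of proximal points
  (\<open>proximal_variational_inequality\<close>): the resolvents of \<open>\<partial>F\<close> and \<open>\<partial>G\<close>, the Riesz representation and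
  with it the adjoint of \<open>K\<close>, and the solvability of the linear system.
\<close>

section \<open>Proximal points in Hilbert spaces\<close>

lemma parallelogram_midpoint:
  fixes u a b :: "'a::real_inner"
  shows "(norm ((1/2) *\<^sub>R a + (1/2) *\<^sub>R b - u))\<^sup>2
    = ((norm (a - u))\<^sup>2 + (norm (b - u))\<^sup>2) / 2 - (norm (a - b))\<^sup>2 / 4"
  unfolding power2_norm_eq_inner
  by (simp add: algebra_simps inner_commute add_divide_distrib diff_divide_distrib)

text \<open>No compactness is needed for the minimiser: the midpoint identity makes the objective strongly
convex, so points with almost minimal objective are close to each other. A minimising sequence is
therefore Cauchy, and the closed sublevel sets pass the bound on \<^term>\<open>f\<close> to its limit. The function
is real-valued on a set \<^term>\<open>D\<close>, so that one lemma serves proper functions (\<^term>\<open>D\<close> the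
effective domain), linear functionals (\<^term>\<open>D\<close> the whole space) and projections onto closed convex
sets (\<^term>\<open>f = (\<lambda>_. 0)\<close>).\<close>

lemma proximal_minimiser_exists:
  fixes f :: "'a::{real_inner,complete_space} \<Rightarrow> real"
  assumes conv: "convex_on D f" and ne: "D \<noteq> {}" and r: "r > 0"
    and cl: "\<And>c. closed {z\<in>D. f z \<le> c}"
    and bdd: "\<And>z. z \<in> D \<Longrightarrow> m \<le> f z + (norm (z - u))\<^sup>2 / (2 * r)"
  obtains p where "p \<in> D"
    "\<And>z. z \<in> D \<Longrightarrow> f p + (norm (p - u))\<^sup>2 / (2 * r) \<le> f z + (norm (z - u))\<^sup>2 / (2 * r)"
proof -
  define h where "h z = f z + (norm (z - u))\<^sup>2 / (2 * r)" for z
  define i where "i = Inf (h ` D)"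
  have bb: "bdd_below (h ` D)" using bdd by (auto simp: h_def bdd_below_def)
  have i_le: "i \<le> h z" if "z \<in> D" for z
    unfolding i_def using bb that by (simp add: cInf_lower)
  have "\<exists>z\<in>D. h z < i + inverse (real (Suc n))" for n
    using cInf_lessD[of "h ` D" "i + inverse (real (Suc n))"] ne by (auto simp: i_def)
  then obtain z where zD: "\<And>n. z n \<in> D" and zh: "\<And>n. h (z n) < i + inverse (real (Suc n))"
    by metis
  have convD: "convex D" using conv by (rule convex_on_imp_convex)
  have mid: "(norm (a - b))\<^sup>2 \<le> 4 * r * (h a + h b - 2 * i)" if "a \<in> D" "b \<in> D" for a b
  proof -
    let ?c = "(1/2) *\<^sub>R a + (1/2) *\<^sub>R b"
    have "?c \<in> D" using convexD[OF convD that, of "1/2" "1/2"] by simp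
    then have "i \<le> h ?c" by (rule i_le)
    moreover have "f ?c \<le> (f a + f b) / 2"
      using convex_onD[OF conv, of "1/2" a b] that by simp
    ultimately have "i \<le> (f a + f b) / 2 + (((norm (a - u))\<^sup>2 + (norm (b - u))\<^sup>2) / 2 - (norm (a - b))\<^sup>2 / 4) / (2 * r)"
      unfolding h_def parallelogram_midpoint by linarith
    also have "\<dots> = (h a + h b) / 2 - (norm (a - b))\<^sup>2 / (8 * r)"
      using r by (simp add: h_def field_simps)
    finally show ?thesis using r by (simp add: field_simps)
  qed
  have Cau: "Cauchy z"
  proof (rule metric_CauchyI)
    fix e :: real assume e: "e > 0"
    then have "e\<^sup>2 / (8 * r) > 0" using r by simp
    then obtain N where N: "inverse (real (Suc N)) < e\<^sup>2 / (8 * r)" using reals_Archimedean by blast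
    have "dist (z j) (z k) < e" if "j \<ge> N" "k \<ge> N" for j k
    proof -
      have le: "inverse (real (Suc l)) \<le> inverse (real (Suc N))" if "l \<ge> N" for l
        using that by (simp add: field_simps)
      have "h (z j) + h (z k) - 2 * i < 2 * (e\<^sup>2 / (8 * r))"
        using zh[of j] zh[of k] le[OF that(1)] le[OF that(2)] N by linarith
      then have "4 * r * (h (z j) + h (z k) - 2 * i) < 4 * r * (2 * (e\<^sup>2 / (8 * r)))"
        using r by (intro mult_strict_left_mono) auto
      also have "\<dots> = e\<^sup>2" using r by simp
      finally have "(norm (z j - z k))\<^sup>2 < e\<^sup>2"
        using mid[OF zD zD, of j k] by linarith
      then show ?thesis using e by (simp add: dist_norm power_less_imp_less_base)
    qed
    then show "\<exists>M. \<forall>m\<ge>M. \<forall>n\<ge>M. dist (z m) (z n) < e" by blast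
  qed
  then obtain p where p: "z \<longlonglongrightarrow> p" using Cauchy_convergent unfolding convergent_def by blast
  have "(\<lambda>n. i + inverse (real (Suc n)) - (norm (z n - u))\<^sup>2 / (2 * r))
      \<longlonglongrightarrow> i + 0 - (norm (p - u))\<^sup>2 / (2 * r)"
    by (intro tendsto_intros p LIMSEQ_inverse_real_of_nat) (use r in simp)
  then have lim: "(\<lambda>n. i + inverse (real (Suc n)) - (norm (z n - u))\<^sup>2 / (2 * r))
      \<longlonglongrightarrow> i - (norm (p - u))\<^sup>2 / (2 * r)" by simp
  have fp: "p \<in> D \<and> f p \<le> i - (norm (p - u))\<^sup>2 / (2 * r) + e" if "e > 0" for e
  proof -
    have "eventually (\<lambda>n. i + inverse (real (Suc n)) - (norm (z n - u))\<^sup>2 / (2 * r) < i - (norm (p - u))\<^sup>2 / (2 * r) + e) sequentially"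
      using order_tendstoD(2)[OF lim, of "i - (norm (p - u))\<^sup>2 / (2 * r) + e"] that by simp
    then have "eventually (\<lambda>n. z n \<in> {z\<in>D. f z \<le> i - (norm (p - u))\<^sup>2 / (2 * r) + e}) sequentially"
    proof eventually_elim
      case (elim n)
      then show ?case using zh[of n] zD[of n] by (simp add: h_def)
    qed
    from Lim_in_closed_set[OF cl this _ p] show ?thesis by simp
  qed
  have "f p \<le> i - (norm (p - u))\<^sup>2 / (2 * r)"
    by (rule field_le_epsilon) (use fp in blast)
  then have "h p \<le> i" by (simp add: h_def)
  show thesis
  proof
    show "p \<in> D" using fp[of 1] by simp
    show "f p + (norm (p - u))\<^sup>2 / (2 * r) \<le> f z + (norm (z - u))\<^sup>2 / (2 * r)" if "z \<in> D" for z
      using \<open>h p \<le> i\<close> i_le[OF that] by (simp add: h_def)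
  qed
qed

text \<open>First-order optimality of the minimiser: compare it with points on the segment towards
\<^term>\<open>z\<close>; the quadratic term contributes only to second order in the segment parameter. The
conclusion says that \<^term>\<open>(u - p) /\<^sub>R r\<close> is a subgradient of \<^term>\<open>f\<close> at \<^term>\<open>p\<close>, relative to
\<^term>\<open>D\<close>.\<close>

lemma proximal_variational_inequality:
  fixes f :: "'a::{real_inner,complete_space} \<Rightarrow> real"
  assumes conv: "convex_on D f" and ne: "D \<noteq> {}" and r: "r > 0"
    and cl: "\<And>c. closed {z\<in>D. f z \<le> c}"
    and bdd: "\<And>z. z \<in> D \<Longrightarrow> m \<le> f z + (norm (z - u))\<^sup>2 / (2 * r)"
  obtains p where "p \<in> D" "\<And>z. z \<in> D \<Longrightarrow> f p + (u - p) \<bullet> (z - p) / r \<le> f z"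
proof -
  obtain p where pD: "p \<in> D"
    and min: "\<And>z. z \<in> D \<Longrightarrow> f p + (norm (p - u))\<^sup>2 / (2 * r) \<le> f z + (norm (z - u))\<^sup>2 / (2 * r)"
    using proximal_minimiser_exists[OF assms] by blast
  show thesis
  proof
    fix v assume v: "v \<in> D"
    let ?q = "(norm (v - p))\<^sup>2 / (2 * r)"
    have step: "f p + (u - p) \<bullet> (v - p) / r \<le> f v + t * ?q" if t: "0 < t" "t < 1" for t
    proof -
      let ?w = "(1 - t) *\<^sub>R p + t *\<^sub>R v"
      have "?w \<in> D"
        using convexD[OF convex_on_imp_convex[OF conv] pD v, of "1 - t" t] t by simp
      then have "f p + (norm (p - u))\<^sup>2 / (2 * r) \<le> f ?w + (norm (?w - u))\<^sup>2 / (2 * r)" by (rule min)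
      moreover have "f ?w \<le> (1 - t) * f p + t * f v"
        using convex_onD[OF conv, of t p v] pD v t by simp
      moreover have "(norm (?w - u))\<^sup>2 / (2 * r)
          = ((norm (p - u))\<^sup>2 - 2 * t * ((u - p) \<bullet> (v - p)) + t\<^sup>2 * (norm (v - p))\<^sup>2) / (2 * r)"
        unfolding power2_norm_eq_inner
        by (simp add: algebra_simps inner_commute power2_eq_square)
      moreover have "\<dots> = (norm (p - u))\<^sup>2 / (2 * r) - t * ((u - p) \<bullet> (v - p) / r) + t * (t * ?q)"
        using r by (simp add: field_simps power2_eq_square)
      ultimately have "t * f p + t * ((u - p) \<bullet> (v - p) / r) \<le> t * f v + t * (t * ?q)"
        using left_diff_distrib[of 1 t "f p"] by linarith
      then have "t * (f p + (u - p) \<bullet> (v - p) / r) \<le> t * (f v + t * ?q)"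
        by (simp add: distrib_left)
      then show ?thesis using t by simp
    qed
    have lim: "((\<lambda>t. f v + t * ?q) \<longlongrightarrow> f v + 0 * ?q) (at_right 0)"
      by (intro tendsto_intros)
    have "eventually (\<lambda>t. f p + (u - p) \<bullet> (v - p) / r \<le> f v + t * ?q) (at_right 0)"
      unfolding eventually_at_right_field by (rule exI[of _ 1]) (use step in auto)
    from tendsto_lowerbound[OF lim this]
    show "f p + (u - p) \<bullet> (v - p) / r \<le> f v" by simp
  qed (rule pD)
qed

section \<open>Riesz representation and adjoints\<close>

text \<open>The representing vector is the proximal point of \<^term>\<open>- \<phi>\<close> at the origin: its variational
inequality bounds \<^term>\<open>\<phi>\<close> by an inner product, and linearity turns the bound into an equality.\<close>

lemma riesz_representation:
  fixes \<phi> :: "'a::{real_inner,complete_space} \<Rightarrow> real"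
  assumes "bounded_linear \<phi>"
  obtains p where "\<And>z. \<phi> z = p \<bullet> z"
proof -
  interpret bounded_linear \<phi> by fact
  have bdd: "- (onorm \<phi>)\<^sup>2 / 2 \<le> - \<phi> z + (norm (z - 0))\<^sup>2 / (2 * 1)" for z
  proof -
    have "\<phi> z \<le> onorm \<phi> * norm z" using onorm[OF assms, of z] by simp
    moreover have "0 \<le> (onorm \<phi> - norm z)\<^sup>2" by simp
    ultimately show ?thesis by (simp add: power2_eq_square algebra_simps)
  qed
  have conv: "convex_on UNIV (\<lambda>z. - \<phi> z)"
    by (rule convex_onI) (auto simp: add scaleR)
  have cl: "closed {z \<in> UNIV. - \<phi> z \<le> c}" for c
    by (auto intro!: closed_Collect_le continuous_intros linear_continuous_on bounded_linear_minus assms)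
  obtain p where p: "- \<phi> p + (0 - p) \<bullet> (z - p) / 1 \<le> - \<phi> z" for z
    using proximal_variational_inequality[OF conv _ _ cl bdd] by (auto simp del: diff_0)
  have le: "\<phi> w \<le> p \<bullet> w" for w
    using p[of "p + w"] by (simp add: add)
  have "\<phi> z = p \<bullet> z" for z
    using le[of z] le[of "- z"] by (simp add: neg)
  then show thesis by (rule that)
qed

text \<open>\<^const>\<open>adjoint\<close> is defined by a choice; the Riesz representation shows that there is something to
choose.\<close>

lemma adjoint_inner:
  fixes K :: "'a::{real_inner,complete_space} \<Rightarrow> 'b::real_inner"
  assumes "bounded_linear K"
  shows "K x \<bullet> y = x \<bullet> adjoint K y"
proof -
  have "\<exists>w. \<forall>x. K x \<bullet> y = x \<bullet> w" for y
    using riesz_representation[OF bounded_linear_compose[OF bounded_linear_inner_left[of y] assms]]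
    by (metis inner_commute)
  then obtain g where "\<forall>x y. K x \<bullet> y = x \<bullet> g y" by metis
  then show ?thesis
    using adjoint_unique[of K g] by simp
qed

lemma bounded_linear_adjoint:
  fixes K :: "'a::{real_inner,complete_space} \<Rightarrow> 'b::real_inner"
  assumes "bounded_linear K"
  shows "bounded_linear (adjoint K)"
proof -
  interpret bounded_linear K by fact
  have eqI: "v = w" if "\<And>x. x \<bullet> v = x \<bullet> w" for v w :: 'a
    using that[of "v - w"] inner_eq_zero_iff[of "v - w"] by (simp add: inner_diff_right)
  show ?thesis
  proof (rule bounded_linear_intro)
    show "adjoint K (x + y) = adjoint K x + adjoint K y" for x y
      by (rule eqI) (simp add: inner_add_right flip: adjoint_inner[OF assms])
    show "adjoint K (r *\<^sub>R x) = r *\<^sub>R adjoint K x" for r x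
      by (rule eqI) (simp flip: adjoint_inner[OF assms])
    show "norm (adjoint K y) \<le> norm y * onorm K" for y
    proof (cases "adjoint K y = 0")
      case False
      have "norm (adjoint K y) * norm (adjoint K y) = K (adjoint K y) \<bullet> y"
        by (simp add: adjoint_inner[OF assms] flip: power2_norm_eq_inner power2_eq_square)
      also have "\<dots> \<le> norm (K (adjoint K y)) * norm y" by (rule norm_cauchy_schwarz)
      also have "\<dots> \<le> (onorm K * norm (adjoint K y)) * norm y"
        by (intro mult_right_mono onorm assms) auto
      finally have "norm (adjoint K y) * norm (adjoint K y) \<le> norm (adjoint K y) * (norm y * onorm K)"
        by (simp add: mult_ac)
      then show ?thesis using False by simp
    qed (simp add: onorm_pos_le[OF assms])
  qed
qed

text \<open>For \<^term>\<open>s = sqrt c\<close>, the point of the closed subspace of all \<^term>\<open>(x, s *\<^sub>R K x)\<close> that is nearest to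
\<^term>\<open>(u, 0)\<close> has its residual orthogonal to this subspace, which is the equation to be solved.
Surjectivity suffices to evaluate the inverse in the iteration.\<close>

lemma surj_id_plus_gram:
  fixes K :: "'a::{real_inner,complete_space} \<Rightarrow> 'b::{real_inner,complete_space}"
  assumes K: "bounded_linear K" and "c > 0"
  shows "surj (\<lambda>z. z + c *\<^sub>R adjoint K (K z))"
proof -
  interpret bounded_linear K by fact
  define s where "s = sqrt c"
  have s: "s * s = c" using \<open>c > 0\<close> by (simp add: s_def)
  let ?D = "{p. snd p = s *\<^sub>R K (fst p)}"
  have "\<exists>x. u = x + c *\<^sub>R adjoint K (K x)" for u
  proof -
    have "convex ?D" by (auto simp: convex_def add scaleR scaleR_add_right mult.commute)
    then have conv: "convex_on ?D (\<lambda>_. 0)" by (intro convex_onI) auto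
    have "closed ?D"
      by (intro closed_Collect_eq continuous_intros bounded_linear.continuous_on[OF K])
    then have cl: "closed {p \<in> ?D. (0::real) \<le> c}" for c
      by (cases "0 \<le> c") auto
    obtain p where p: "p \<in> ?D"
      and var: "\<And>q. q \<in> ?D \<Longrightarrow> 0 + ((u, 0) - p) \<bullet> (q - p) / 1 \<le> 0"
    proof (rule proximal_variational_inequality[OF conv _ _ cl])
      have "(0, 0) \<in> ?D" by simp
      then show "?D \<noteq> {}" by blast
      show "0 \<le> 0 + (norm (q - (u, 0)))\<^sup>2 / (2 * 1)" for q :: "'a \<times> 'b" by simp
    qed auto
    define x where "x = fst p"
    have px: "p = (x, s *\<^sub>R K x)" using p by (simp add: x_def prod_eq_iff)
    have le: "(u - x - c *\<^sub>R adjoint K (K x)) \<bullet> h \<le> 0" for h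
    proof -
      have "(u - x) \<bullet> h - s * s * (K x \<bullet> K h) \<le> 0"
        using var[of "p + (h, s *\<^sub>R K h)"] by (simp add: px add scaleR_add_right mult.assoc)
      moreover have "K x \<bullet> K h = adjoint K (K x) \<bullet> h"
        using adjoint_inner[OF K, of h "K x"] by (simp add: inner_commute)
      ultimately show ?thesis by (simp add: s inner_diff_left)
    qed
    have "u - x - c *\<^sub>R adjoint K (K x) = 0"
      using le[of "u - x - c *\<^sub>R adjoint K (K x)"]
      by (metis inner_ge_zero inner_eq_zero_iff order_antisym)
    then show ?thesis by (intro exI[of _ x]) (simp add: algebra_simps)
  qed
  then show ?thesis by (auto simp: surj_def)
qed

section \<open>Weak limits and weak cluster points\<close>

text \<open>Limits along an arbitrary filter allow weak cluster points to be expressed by finer filters in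
place of subsequences, which avoids any separability or diagonal argument.\<close>

definition weak_limit_along :: "'i filter \<Rightarrow> ('i \<Rightarrow> 'a::real_inner) \<Rightarrow> 'a \<Rightarrow> bool" where
  "weak_limit_along U u p \<longleftrightarrow> (\<forall>v. ((\<lambda>i. u i \<bullet> v) \<longlongrightarrow> p \<bullet> v) U)"

text \<open>Each \<^term>\<open>u i\<close> is identified with the functional \<^term>\<open>\<lambda>v. u i \<bullet> v\<close>, a point of a product of compact
intervals. Tychonoff's theorem gives a cluster point in this product; it is linear and bounded as a
pointwise limit of such functionals, so the Riesz representation turns it back into a vector.\<close>

lemma weak_cluster_point_exists:
  fixes u :: "'i \<Rightarrow> 'a::{real_inner,complete_space}"
  assumes Fl: "Fl \<noteq> bot" and bound: "\<And>i. norm (u i) \<le> C"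
  shows "\<exists>U p. U \<le> Fl \<and> U \<noteq> bot \<and> weak_limit_along U u p"
proof -
  define \<Phi> where "\<Phi> i = (\<lambda>v. u i \<bullet> v)" for i
  define S where "S = PiE UNIV (\<lambda>v::'a. {- (C * norm v)..C * norm v})"
  have "compactin (product_topology (\<lambda>_. euclidean) UNIV) S"
    unfolding S_def compactin_PiE by simp
  then have "compact S" by (simp add: euclidean_product_topology)
  have "\<Phi> i \<in> S" for i
  proof -
    have "\<bar>u i \<bullet> v\<bar> \<le> C * norm v" for v
      using Cauchy_Schwarz_ineq2[of "u i" v] mult_right_mono[OF bound[of i] norm_ge_zero[of v]] by linarith
    then show ?thesis by (auto simp: S_def \<Phi>_def abs_le_iff minus_le_iff)
  qed
  then have "eventually (\<lambda>f. f \<in> S) (filtermap \<Phi> Fl)" by (simp add: eventually_filtermap)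
  moreover have "filtermap \<Phi> Fl \<noteq> bot" using Fl by (simp add: filtermap_bot_iff)
  ultimately obtain \<phi> where \<phi>S: "\<phi> \<in> S" and \<phi>: "inf (nhds \<phi>) (filtermap \<Phi> Fl) \<noteq> bot"
    using \<open>compact S\<close> unfolding compact_filter by blast
  define U where "U = inf Fl (filtercomap \<Phi> (nhds \<phi>))"
  have "U \<noteq> bot"
  proof
    assume "U = bot"
    then have "eventually (\<lambda>_. False) U" by simp
    then obtain P Q where P: "eventually P Fl" and Q: "eventually Q (filtercomap \<Phi> (nhds \<phi>))"
      and PQ: "\<And>i. P i \<Longrightarrow> Q i \<Longrightarrow> False"
      unfolding U_def eventually_inf by blast
    obtain R where R: "eventually R (nhds \<phi>)" and RQ: "\<And>i. R (\<Phi> i) \<Longrightarrow> Q i"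
      using Q unfolding eventually_filtercomap by blast
    have "eventually (\<lambda>f. \<not> R f) (filtermap \<Phi> Fl)"
      unfolding eventually_filtermap by (rule eventually_mono[OF P]) (use PQ RQ in blast)
    with R have "eventually (\<lambda>_. False) (inf (nhds \<phi>) (filtermap \<Phi> Fl))"
      unfolding eventually_inf by blast
    with \<phi> show False by (simp add: eventually_False)
  qed
  have "filterlim \<Phi> (nhds \<phi>) U"
    unfolding U_def by (rule filterlim_mono[OF filterlim_filtercomap]) auto
  then have lim: "((\<lambda>i. u i \<bullet> v) \<longlongrightarrow> \<phi> v) U" for v
    using continuous_on_tendsto_compose[OF continuous_on_product_coordinates,  of \<Phi> \<phi> U v]
    by (simp add: \<Phi>_def)
  have "bounded_linear \<phi>"
  proof (rule bounded_linear_intro)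
    show "\<phi> (x + y) = \<phi> x + \<phi> y" for x y
      using tendsto_add[OF lim[of x] lim[of y]] lim[of "x + y"] \<open>U \<noteq> bot\<close>
      by (simp add: inner_add_right tendsto_unique)
    show "\<phi> (r *\<^sub>R x) = r *\<^sub>R \<phi> x" for r x
      using tendsto_mult_left[OF lim[of x], of r] lim[of "r *\<^sub>R x"] \<open>U \<noteq> bot\<close>
      by (simp add: tendsto_unique)
    show "norm (\<phi> x) \<le> norm x * C" for x
      using \<phi>S by (auto simp: S_def PiE_iff abs_le_iff minus_le_iff mult.commute)
  qed
  then obtain p where "\<And>v. \<phi> v = p \<bullet> v" using riesz_representation by blast
  with lim have "weak_limit_along U u p" by (simp add: weak_limit_along_def)
  moreover have "U \<le> Fl" by (simp add: U_def)
  ultimately show ?thesis using \<open>U \<noteq> bot\<close> by blast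
qed

lemma weakly_converges_to_if_weak_limit:
  fixes u :: "nat \<Rightarrow> 'a::{real_inner,complete_space}"
  assumes "weak_limit_along sequentially u p"
  shows "weakly_converges_to u p"
  unfolding weakly_converges_to_def
proof (intro allI impI)
  fix f :: "'a \<Rightarrow> real" assume "bounded_linear f"
  then obtain v where "\<And>x. f x = x \<bullet> v" using riesz_representation inner_commute by metis
  then show "(\<lambda>n. f (u n)) \<longlonglongrightarrow> f p"
    using assms by (simp add: weak_limit_along_def)
qed

text \<open>If \<^term>\<open>u\<close> did not converge to its weak cluster point, it would frequently stay outside a weak
neighbourhood of it; restricting the filter to those indices yields a second cluster point.\<close>

lemma weak_limit_if_unique_cluster_point:
  fixes u :: "'i \<Rightarrow> 'a::{real_inner,complete_space}"
  assumes Fl: "Fl \<noteq> bot" and bound: "\<And>i. norm (u i) \<le> C"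
    and uniq: "\<And>U V p q. U \<le> Fl \<Longrightarrow> U \<noteq> bot \<Longrightarrow> weak_limit_along U u p \<Longrightarrow>
      V \<le> Fl \<Longrightarrow> V \<noteq> bot \<Longrightarrow> weak_limit_along V u q \<Longrightarrow> p = q"
  obtains p where "weak_limit_along Fl u p"
proof -
  obtain U p where U: "U \<le> Fl" "U \<noteq> bot" "weak_limit_along U u p"
    using weak_cluster_point_exists[of Fl u C, OF Fl bound] by blast
  have ev: "eventually (\<lambda>i. u i \<bullet> v \<in> S) Fl" if S: "open S" "p \<bullet> v \<in> S" for v S
  proof (rule ccontr)
    assume neg: "\<not> eventually (\<lambda>i. u i \<bullet> v \<in> S) Fl"
    define G where "G = inf Fl (principal {i. u i \<bullet> v \<notin> S})"
    have "G \<noteq> bot"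
      using neg unfolding G_def trivial_limit_def eventually_inf_principal by simp
    obtain V q where V: "V \<le> G" "V \<noteq> bot" "weak_limit_along V u q"
      using weak_cluster_point_exists[of G u C, OF \<open>G \<noteq> bot\<close> bound] by blast
    have "V \<le> Fl" using V(1) by (simp add: G_def)
    then have "p = q" using uniq[OF U _ V(2,3)] by blast
    then have "((\<lambda>i. u i \<bullet> v) \<longlongrightarrow> p \<bullet> v) V" using V(3) by (simp add: weak_limit_along_def)
    then have "eventually (\<lambda>i. u i \<bullet> v \<in> S) V" using S by (rule topological_tendstoD)
    moreover have "eventually (\<lambda>i. u i \<bullet> v \<notin> S) V"
      using V(1) by (rule filter_leD) (simp add: G_def eventually_inf_principal)
    ultimately have "eventually (\<lambda>_. False) V" by (rule eventually_elim2) simp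
    with V(2) show False by (simp add: eventually_False)
  qed
  have "weak_limit_along Fl u p"
    unfolding weak_limit_along_def
  proof (intro allI topological_tendstoI)
    fix v S assume "open S" "p \<bullet> v \<in> S"
    then show "eventually (\<lambda>i. u i \<bullet> v \<in> S) Fl" by (rule ev)
  qed
  then show thesis by (rule that)
qed

lemma weakly_converges_to_add_null:
  assumes "weakly_converges_to u p" "e \<longlonglongrightarrow> 0"
  shows "weakly_converges_to (\<lambda>n. u n + e n) p"
  unfolding weakly_converges_to_def
proof (intro allI impI)
  fix f :: "'a \<Rightarrow> real" assume f: "bounded_linear f"
  then interpret bounded_linear f .
  have "(\<lambda>n. f (u n) + f (e n)) \<longlonglongrightarrow> f p + f 0"
    using assms(1) f tendsto[OF assms(2)]
    by (intro tendsto_add) (auto simp: weakly_converges_to_def)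
  then show "(\<lambda>n. f (u n + e n)) \<longlonglongrightarrow> f p" by (simp add: add zero)
qed

lemma weakly_converges_to_bounded_linear_image:
  assumes "bounded_linear T" "weakly_converges_to u p"
  shows "weakly_converges_to (\<lambda>n. T (u n)) (T p)"
  using assms bounded_linear_compose[OF _ assms(1)]
  unfolding weakly_converges_to_def by blast

section \<open>Splitting for a monotone plus a skew-symmetric operator\<close>

text \<open>The iteration for finding a zero of a sum of a monotone relation \<open>M\<close> and a bounded
skew-symmetric operator \<open>A\<close>. The first two steps are resolvents written as inclusions, and
\<open>zb\<close> is the governing sequence. Solvability of \<open>(p, u - p) \<in> M\<close> for every \<open>u\<close> is Minty's characterisation of maximal
monotonicity, in the form in which it is used.\<close>

locale douglas_rachford =
  fixes M :: "('h::{real_inner,complete_space} \<times> 'h) set" and A :: "'h \<Rightarrow> 'h"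
    and z w zb :: "nat \<Rightarrow> 'h"
  assumes monotone: "(p, g) \<in> M \<Longrightarrow> (p', g') \<in> M \<Longrightarrow> 0 \<le> (p - p') \<bullet> (g - g')"
    and full_range: "\<exists>p. (p, u - p) \<in> M"
    and A: "bounded_linear A" and skew: "A p \<bullet> p = 0"
    and step_M: "(z (Suc k), zb k - z (Suc k)) \<in> M"
    and step_A: "w (Suc k) + A (w (Suc k)) = 2 *\<^sub>R z (Suc k) - zb k"
    and update: "zb (Suc k) = zb k - z (Suc k) + w (Suc k)"
begin

text \<open>Pairs of a zero \<open>p\<close> of \<open>M + A\<close> and a fixed point \<open>q\<close> of the iteration that yields it: the governing
sequence started at \<open>q\<close> stays there and produces \<open>p\<close>.\<close>

definition equilibria :: "('h \<times> 'h) set" where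
  "equilibria = {(p, q). (p, q - p) \<in> M \<and> A p = p - q}"

lemma equilibriaD:
  assumes "(p, q) \<in> equilibria"
  shows "(p, q - p) \<in> M" "A p = p - q"
  using assms by (auto simp: equilibria_def)

text \<open>The map from one governing point to the next is firmly nonexpansive. The defect of the
inequality is twice the sum of the monotonicity term of \<^term>\<open>M\<close> and that of \<^term>\<open>A\<close>, and the latter
vanishes by skew symmetry.\<close>

lemma fejer:
  assumes "(p, q) \<in> equilibria"
  shows "(norm (zb (Suc k) - q))\<^sup>2 + (norm (zb (Suc k) - zb k))\<^sup>2 \<le> (norm (zb k - q))\<^sup>2"
proof -
  interpret A: bounded_linear A by (rule A)
  define a c e where "a = z (Suc k) - p" and "c = zb k - q" and "e = w (Suc k) - p"
  have 1: "0 \<le> a \<bullet> (c - a)"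
    using monotone[OF step_M[of k] equilibriaD(1)[OF assms]] by (simp add: a_def c_def algebra_simps)
  have "A e = 2 *\<^sub>R a - c - e"
    using step_A[of k] equilibriaD(2)[OF assms]
    by (simp add: a_def c_def e_def A.diff algebra_simps) (simp add: scaleR_2 algebra_simps)
  then have 2: "(2 *\<^sub>R a - c - e) \<bullet> e = 0" using skew[of e] by simp
  have 3: "zb (Suc k) - q = c - a + e" "zb (Suc k) - zb k = e - a"
    by (simp_all add: update a_def c_def e_def)
  have "(norm (c - a + e))\<^sup>2 + (norm (e - a))\<^sup>2
      = (norm c)\<^sup>2 - 2 * (a \<bullet> (c - a)) - 2 * ((2 *\<^sub>R a - c - e) \<bullet> e)"
    unfolding power2_norm_eq_inner by (simp add: algebra_simps inner_commute)
  then have "(norm (c - a + e))\<^sup>2 + (norm (e - a))\<^sup>2 \<le> (norm c)\<^sup>2" using 1 2 by simp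
  then show ?thesis unfolding 3 by (simp add: c_def)
qed

lemma distance_decseq:
  assumes "(p, q) \<in> equilibria"
  shows "decseq (\<lambda>k. (norm (zb k - q))\<^sup>2)"
proof (rule decseq_SucI)
  show "(norm (zb (Suc k) - q))\<^sup>2 \<le> (norm (zb k - q))\<^sup>2" for k
    using fejer[OF assms, of k] zero_le_power2[of "norm (zb (Suc k) - zb k)"] by linarith
qed

lemma distance_converges:
  assumes "(p, q) \<in> equilibria"
  obtains l where "(\<lambda>k. (norm (zb k - q))\<^sup>2) \<longlonglongrightarrow> l"
  using decseq_convergent[OF distance_decseq[OF assms], of 0] by auto

lemma residual_tendsto_zero:
  assumes "(p, q) \<in> equilibria"
  shows "(\<lambda>k. zb (Suc k) - zb k) \<longlonglongrightarrow> 0"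
proof -
  obtain l where l: "(\<lambda>k. (norm (zb k - q))\<^sup>2) \<longlonglongrightarrow> l" using distance_converges[OF assms] .
  have "(\<lambda>k. (norm (zb k - q))\<^sup>2 - (norm (zb (Suc k) - q))\<^sup>2) \<longlonglongrightarrow> l - l"
    by (intro tendsto_diff l LIMSEQ_Suc)
  then have lim: "(\<lambda>k. (norm (zb k - q))\<^sup>2 - (norm (zb (Suc k) - q))\<^sup>2) \<longlonglongrightarrow> 0" by simp
  have le: "(norm (zb (Suc k) - zb k))\<^sup>2 \<le> (norm (zb k - q))\<^sup>2 - (norm (zb (Suc k) - q))\<^sup>2" for k
    using fejer[OF assms, of k] by linarith
  have "(\<lambda>k. (norm (zb (Suc k) - zb k))\<^sup>2) \<longlonglongrightarrow> 0"
    by (rule Lim_null_comparison[OF always_eventually lim]) (simp add: le)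
  then have "(\<lambda>k. sqrt ((norm (zb (Suc k) - zb k))\<^sup>2)) \<longlonglongrightarrow> sqrt 0" by (rule tendsto_real_sqrt)
  then show ?thesis by (simp add: tendsto_norm_zero_iff)
qed

lemma resolvent_nonexpansive:
  assumes "(p, q - p) \<in> M" "(p', q' - p') \<in> M"
  shows "norm (p - p') \<le> norm (q - q')"
proof -
  have "0 \<le> (p - p') \<bullet> ((q - q') - (p - p'))"
    using monotone[OF assms] by (simp add: algebra_simps)
  then have "(norm (p - p'))\<^sup>2 \<le> (p - p') \<bullet> (q - q')"
    by (simp add: inner_diff_right power2_norm_eq_inner)
  also have "\<dots> \<le> norm (p - p') * norm (q - q')" by (rule norm_cauchy_schwarz)
  finally show ?thesis
    by (cases "p = p'") (simp_all add: power2_eq_square)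
qed

lemma iterates_bounded:
  assumes "(p, q) \<in> equilibria"
  shows "\<exists>C. \<forall>k. norm (zb k) \<le> C \<and> norm (z (Suc k), zb k) \<le> C"
proof -
  have "(norm (zb k - q))\<^sup>2 \<le> (norm (zb 0 - q))\<^sup>2" for k
    using decseqD[OF distance_decseq[OF assms], of 0 k] by simp
  then have q: "norm (zb k - q) \<le> norm (zb 0 - q)" for k
    using power2_le_imp_le norm_ge_zero by blast
  then have p: "norm (z (Suc k) - p) \<le> norm (zb 0 - q)" for k
    using resolvent_nonexpansive[OF step_M equilibriaD(1)[OF assms], of k] order_trans by blast
  have zb: "norm (zb k) \<le> norm (zb 0 - q) + norm q" for k
    using norm_triangle_sub[of "zb k" q] q[of k] by linarith
  have zz: "norm (z (Suc k)) \<le> norm (zb 0 - q) + norm p" for k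
    using norm_triangle_sub[of "z (Suc k)" p] p[of k] by linarith
  show ?thesis
  proof (intro exI allI conjI)
    let ?C = "(norm (zb 0 - q) + norm p) + (norm (zb 0 - q) + norm q)"
    fix k
    show "norm (z (Suc k), zb k) \<le> ?C"
      using norm_Pair_le[of "z (Suc k)" "zb k"] zb[of k] zz[of k] by linarith
    show "norm (zb k) \<le> ?C"
      using zb[of k] norm_ge_zero[of p] norm_ge_zero[of "zb 0 - q"] by linarith
  qed
qed

text \<open>The graph of a maximal monotone relation is not weakly closed in general, but a pair of weak limits
\<^term>\<open>(p, g)\<close> belongs to it as soon as the inner products along the graph tend to \<^term>\<open>p \<bullet> g\<close>. Skew
symmetry supplies this: up to terms in the residual \<^term>\<open>zb (Suc k) - zb k\<close>, which tends to zero strongly,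
\<^term>\<open>zb k - z (Suc k)\<close> equals \<^term>\<open>- A (z (Suc k))\<close> and is therefore orthogonal to
\<^term>\<open>z (Suc k)\<close>; the weak limits are orthogonal for the same reason. The equation for \<^term>\<open>A\<close>
passes to the limit because bounded linear operators are weakly continuous.\<close>

lemma weak_cluster_points_are_equilibria:
  assumes eq: "equilibria \<noteq> {}" and U: "U \<le> sequentially" "U \<noteq> bot"
    and lim: "weak_limit_along U (\<lambda>k. (z (Suc k), zb k)) (p, q)"
  shows "(p, q) \<in> equilibria"
proof -
  obtain p0 q0 where "(p0, q0) \<in> equilibria" using eq by auto
  note e0 = this
  define r where "r k = zb (Suc k) - zb k" for k
  have w: "w (Suc k) = z (Suc k) + r k" for k
    by (simp add: r_def update)
  have r0: "(r \<longlongrightarrow> 0) U"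
    using tendsto_mono[OF U(1) residual_tendsto_zero[OF e0]] by (simp add: r_def[abs_def])
  have z: "((\<lambda>k. z (Suc k) \<bullet> v) \<longlongrightarrow> p \<bullet> v) U" and zb: "((\<lambda>k. zb k \<bullet> v) \<longlongrightarrow> q \<bullet> v) U" for v
    using lim[unfolded weak_limit_along_def, rule_format, of "(v, 0)"]
      lim[unfolded weak_limit_along_def, rule_format, of "(0, v)"] by simp_all
  have rv: "((\<lambda>k. r k \<bullet> v) \<longlongrightarrow> 0) U" for v
    using tendsto_inner[OF r0 tendsto_const[of v]] by simp
  have Aw: "A (w (Suc k)) = z (Suc k) - zb k - r k" for k
    using step_A[of k] w[of k] by (simp add: scaleR_2 algebra_simps)
  have "A p \<bullet> v = (p - q) \<bullet> v" for v
  proof (rule tendsto_unique[OF U(2)])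
    have "((\<lambda>k. (z (Suc k) + r k) \<bullet> adjoint A v) \<longlongrightarrow> p \<bullet> adjoint A v + 0) U"
      unfolding inner_add_left by (intro tendsto_add z rv)
    then show "((\<lambda>k. A (w (Suc k)) \<bullet> v) \<longlongrightarrow> A p \<bullet> v) U"
      by (simp add: w adjoint_inner[OF A])
    have "((\<lambda>k. (z (Suc k) - zb k - r k) \<bullet> v) \<longlongrightarrow> p \<bullet> v - q \<bullet> v - 0) U"
      unfolding inner_diff_left by (intro tendsto_diff z zb rv)
    then show "((\<lambda>k. A (w (Suc k)) \<bullet> v) \<longlongrightarrow> (p - q) \<bullet> v) U"
      by (simp add: Aw inner_diff_left)
  qed
  from this[of "A p - (p - q)"] have Ap: "A p = p - q"
    by (metis inner_diff_left inner_eq_zero_iff right_minus_eq)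
  obtain C where C: "\<And>k. norm (zb k) \<le> C"
    using iterates_bounded[OF e0] by blast
  have "((\<lambda>k. r k \<bullet> zb k) \<longlongrightarrow> 0) U"
  proof (rule Lim_null_comparison)
    show "eventually (\<lambda>k. norm (r k \<bullet> zb k) \<le> norm (r k) * C) U"
    proof (rule always_eventually, rule allI)
      fix k
      have "norm (r k \<bullet> zb k) \<le> norm (r k) * norm (zb k)"
        by (simp add: Cauchy_Schwarz_ineq2)
      also have "\<dots> \<le> norm (r k) * C" by (intro mult_left_mono C) simp
      finally show "norm (r k \<bullet> zb k) \<le> norm (r k) * C" .
    qed
    show "((\<lambda>k. norm (r k) * C) \<longlongrightarrow> 0) U"
      using tendsto_mult_right[OF tendsto_norm[OF r0], of C] by simp
  qed
  then have "((\<lambda>k. - (r k \<bullet> zb k) - r k \<bullet> r k) \<longlongrightarrow> - 0 - (0::'h) \<bullet> 0) U"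
    by (intro tendsto_diff tendsto_minus tendsto_inner[OF r0 r0])
  moreover have "z (Suc k) \<bullet> (zb k - z (Suc k)) = - (r k \<bullet> zb k) - r k \<bullet> r k" for k
  proof -
    have "(z (Suc k) - zb k - r k) \<bullet> (z (Suc k) + r k) = 0"
      using skew[of "w (Suc k)"] unfolding Aw by (simp add: w)
    then show ?thesis by (simp add: algebra_simps inner_commute)
  qed
  ultimately have zM: "((\<lambda>k. z (Suc k) \<bullet> (zb k - z (Suc k))) \<longlongrightarrow> 0) U" by simp
  obtain p' where p': "(p', q - p') \<in> M" using full_range by blast
  \<comment> \<open>Minty's trick: test monotonicity against the resolvent of the weak limit.\<close>
  have "((\<lambda>k. z (Suc k) \<bullet> (zb k - z (Suc k)) - z (Suc k) \<bullet> (q - p')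
       - (zb k \<bullet> p' - z (Suc k) \<bullet> p') + p' \<bullet> (q - p'))
      \<longlongrightarrow> 0 - p \<bullet> (q - p') - (q \<bullet> p' - p \<bullet> p') + p' \<bullet> (q - p')) U"
    by (intro tendsto_intros z zb zM)
  moreover have "z (Suc k) \<bullet> (zb k - z (Suc k)) - z (Suc k) \<bullet> (q - p')
       - (zb k \<bullet> p' - z (Suc k) \<bullet> p') + p' \<bullet> (q - p') \<ge> 0" for k
    using monotone[OF step_M[of k] p'] by (simp add: algebra_simps inner_commute)
  ultimately have "0 \<le> 0 - p \<bullet> (q - p') - (q \<bullet> p' - p \<bullet> p') + p' \<bullet> (q - p')"
    using tendsto_lowerbound[OF _ _ U(2)] by (metis (mono_tags, lifting) always_eventually)
  moreover have "p \<bullet> q = p \<bullet> p" using skew[of p] by (simp add: Ap algebra_simps inner_commute)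
  ultimately have "(p - p') \<bullet> (p - p') \<le> 0" by (simp add: algebra_simps inner_commute)
  then have "p = p'" by (metis inner_eq_zero_iff inner_ge_zero order_antisym right_minus_eq)
  with p' Ap show ?thesis by (simp add: equilibria_def)
qed

text \<open>Opial's argument: the distances to two equilibria converge, so the inner products of the governing
sequence with their difference converge too, and the two weak limits agree on that difference. The
second components being equal, nonexpansiveness of the resolvent identifies the first ones. Taking
cluster points of the pair sequence is what makes \<^term>\<open>z\<close> converge along with \<^term>\<open>zb\<close>, although the
resolvent need not be weakly continuous.\<close>

lemma weak_cluster_point_unique:
  assumes eq: "equilibria \<noteq> {}"
    and U: "U \<le> sequentially" "U \<noteq> bot" "weak_limit_along U (\<lambda>k. (z (Suc k), zb k)) (p, q)"
    and V: "V \<le> sequentially" "V \<noteq> bot" "weak_limit_along V (\<lambda>k. (z (Suc k), zb k)) (p', q')"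
  shows "(p, q) = (p', q')"
proof -
  have e: "(p, q) \<in> equilibria" "(p', q') \<in> equilibria"
    using weak_cluster_points_are_equilibria[OF eq] U V by blast+
  obtain l where l: "(\<lambda>k. (norm (zb k - q))\<^sup>2) \<longlonglongrightarrow> l" using distance_converges[OF e(1)] .
  obtain l' where l': "(\<lambda>k. (norm (zb k - q'))\<^sup>2) \<longlonglongrightarrow> l'" using distance_converges[OF e(2)] .
  have "(\<lambda>k. ((norm (zb k - q'))\<^sup>2 - (norm (zb k - q))\<^sup>2 + (q \<bullet> q - q' \<bullet> q')) / 2)
      \<longlonglongrightarrow> (l' - l + (q \<bullet> q - q' \<bullet> q')) / 2"
    by (intro tendsto_intros l l') simp
  moreover have "((norm (zb k - q'))\<^sup>2 - (norm (zb k - q))\<^sup>2 + (q \<bullet> q - q' \<bullet> q')) / 2 = zb k \<bullet> (q - q')" for k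
    unfolding power2_norm_eq_inner by (simp add: algebra_simps inner_commute diff_divide_distrib)
  ultimately obtain m where m: "(\<lambda>k. zb k \<bullet> (q - q')) \<longlonglongrightarrow> m" by auto
  have "((\<lambda>k. zb k \<bullet> (q - q')) \<longlongrightarrow> q \<bullet> (q - q')) U" "((\<lambda>k. zb k \<bullet> (q - q')) \<longlongrightarrow> q' \<bullet> (q - q')) V"
    using U(3)[unfolded weak_limit_along_def, rule_format, of "(0, q - q')"]
      V(3)[unfolded weak_limit_along_def, rule_format, of "(0, q - q')"] by simp_all
  then have "q \<bullet> (q - q') = m" "q' \<bullet> (q - q') = m"
    using tendsto_mono[OF U(1) m] tendsto_mono[OF V(1) m] U(2) V(2) tendsto_unique by blast+
  then have "(q - q') \<bullet> (q - q') = 0" by (simp add: inner_diff_left)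
  then have "q = q'" by simp
  with resolvent_nonexpansive[OF equilibriaD(1)[OF e(1)] equilibriaD(1)[OF e(2)]]
  show ?thesis by simp
qed

theorem weak_convergence:
  assumes eq: "equilibria \<noteq> {}"
  obtains p q where "(p, q) \<in> equilibria"
    "weakly_converges_to (\<lambda>k. (z (Suc k), zb (Suc k))) (p, q)"
proof -
  obtain p0 q0 where e0: "(p0, q0) \<in> equilibria" using eq by auto
  obtain C where C: "\<And>k. norm (z (Suc k), zb k) \<le> C"
    using iterates_bounded[OF e0] by blast
  have uniq: "pq = pq'"
    if "U \<le> sequentially" "U \<noteq> bot" "weak_limit_along U (\<lambda>k. (z (Suc k), zb k)) pq"
      "V \<le> sequentially" "V \<noteq> bot" "weak_limit_along V (\<lambda>k. (z (Suc k), zb k)) pq'" for U V pq pq'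
    using weak_cluster_point_unique[OF eq, of U "fst pq" "snd pq" V "fst pq'" "snd pq'"] that by simp
  obtain pq where lim: "weak_limit_along sequentially (\<lambda>k. (z (Suc k), zb k)) pq"
    using weak_limit_if_unique_cluster_point[OF sequentially_bot C uniq] .
  obtain p q where pq: "pq = (p, q)" by (cases pq)
  have "(\<lambda>k. (0::'h, zb (Suc k) - zb k)) \<longlonglongrightarrow> (0, 0)"
    by (intro tendsto_Pair tendsto_const residual_tendsto_zero[OF e0])
  then have "(\<lambda>k. (0::'h, zb (Suc k) - zb k)) \<longlonglongrightarrow> 0" by (simp only: zero_prod_def)
  then have "weakly_converges_to (\<lambda>k. (z (Suc k), zb k) + (0, zb (Suc k) - zb k)) (p, q)"
    by (rule weakly_converges_to_add_null[OF weakly_converges_to_if_weak_limit[OF lim[unfolded pq]]])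
  moreover have "(z (Suc k), zb k) + (0, zb (Suc k) - zb k) = (z (Suc k), zb (Suc k))" for k by simp
  ultimately have "weakly_converges_to (\<lambda>k. (z (Suc k), zb (Suc k))) (p, q)" by (simp only:)
  moreover have "(p, q) \<in> equilibria"
    using weak_cluster_points_are_equilibria[OF eq order_refl sequentially_bot lim[unfolded pq]] .
  ultimately show thesis by (intro that)
qed

end

section \<open>Subdifferentials of proper convex functions\<close>

lemma closed_sublevel:
  assumes "lsc_fun F"
  shows "closed {z. F z \<le> ereal c}"
proof -
  have "open {z. ereal c < F z}"
  proof (subst open_subopen, intro ballI)
    fix x assume "x \<in> {z. ereal c < F z}"
    then have x: "ereal c < F x" by simp
    with assms have "ereal c < Liminf (at x) F"
      unfolding lsc_fun_def by (metis order_less_le_trans)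
    then have "eventually (\<lambda>z. ereal c < F z) (at x)" by (rule less_LiminfD)
    with x have "eventually (\<lambda>z. ereal c < F z) (nhds x)" by (simp add: eventually_nhds_conv_at)
    then show "\<exists>T. open T \<and> x \<in> T \<and> T \<subseteq> {z. ereal c < F z}"
      unfolding eventually_nhds by blast
  qed
  moreover have "- {z. F z \<le> ereal c} = {z. ereal c < F z}" by auto
  ultimately show ?thesis by (simp only: closed_def)
qed

lemma proper_fun_real:
  assumes "proper_fun F" "x \<in> eff_dom F"
  shows "\<exists>a. F x = ereal a"
  using assms by (cases "F x") (auto simp: proper_fun_def eff_dom_def)

lemma real_of_proper_fun:
  assumes "proper_fun F" "x \<in> eff_dom F"
  shows "ereal (real_of_ereal (F x)) = F x"
  using proper_fun_real[OF assms] by auto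

lemma convex_on_eff_dom:
  fixes F :: "'a::real_vector \<Rightarrow> ereal"
  assumes F: "proper_fun F" "convex_fun F"
  shows "convex_on (eff_dom F) (\<lambda>x. real_of_ereal (F x))"
proof -
  have *: "(1 - t) *\<^sub>R x + t *\<^sub>R y \<in> eff_dom F \<and>
      real_of_ereal (F ((1 - t) *\<^sub>R x + t *\<^sub>R y)) \<le> (1 - t) * real_of_ereal (F x) + t * real_of_ereal (F y)"
    if t: "0 < t" "t < 1" and xy: "x \<in> eff_dom F" "y \<in> eff_dom F" for t x y
  proof -
    let ?w = "(1 - t) *\<^sub>R x + t *\<^sub>R y"
    obtain a b where ab: "F x = ereal a" "F y = ereal b"
      using proper_fun_real[OF F(1)] xy by metis
    have le: "F ?w \<le> ereal ((1 - t) * a + t * b)"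
      using F(2) t ab unfolding convex_fun_def by (metis plus_ereal.simps(1) times_ereal.simps(1))
    then have w: "?w \<in> eff_dom F" by (auto simp: eff_dom_def)
    then obtain c where "F ?w = ereal c" using proper_fun_real[OF F(1)] by blast
    with w le ab show ?thesis by simp
  qed
  have "convex (eff_dom F)"
    unfolding convex_alt
  proof (intro ballI allI impI)
    fix x y and u :: real assume "x \<in> eff_dom F" "y \<in> eff_dom F" "0 \<le> u \<and> u \<le> 1"
    then show "(1 - u) *\<^sub>R x + u *\<^sub>R y \<in> eff_dom F"
      using *[of u x y] by (cases "u = 0 \<or> u = 1") auto
  qed
  with * show ?thesis by (intro convex_onI) auto
qed

text \<open>Outside the effective domain the subgradient inequality holds trivially, so subgradients can be
handled in real arithmetic.\<close>

lemma subdifferential_real_iff: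
  assumes "proper_fun F"
  shows "g \<in> subdifferential F x \<longleftrightarrow> x \<in> eff_dom F \<and>
    (\<forall>z\<in>eff_dom F. real_of_ereal (F x) + g \<bullet> (z - x) \<le> real_of_ereal (F z))"
proof (cases "x \<in> eff_dom F")
  case True
  have "F x + ereal (g \<bullet> (z - x)) \<le> F z \<longleftrightarrow>
      (z \<in> eff_dom F \<longrightarrow> real_of_ereal (F x) + g \<bullet> (z - x) \<le> real_of_ereal (F z))" for z
  proof (cases "z \<in> eff_dom F")
    case zD: True
    obtain a b where "F x = ereal a" "F z = ereal b"
      using proper_fun_real[OF assms] True zD by metis
    then show ?thesis using zD by simp
  next
    case False
    then have "F z = \<infinity>" by (simp add: eff_dom_def)
    then show ?thesis using False by simp
  qed
  then show ?thesis using True by (auto simp: subdifferential_def)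
qed (simp add: subdifferential_def)

lemma subdifferential_monotone:
  assumes "proper_fun F" "g \<in> subdifferential F p" "g' \<in> subdifferential F p'"
  shows "0 \<le> (p - p') \<bullet> (g - g')"
proof -
  have "real_of_ereal (F p) + g \<bullet> (p' - p) \<le> real_of_ereal (F p')"
    "real_of_ereal (F p') + g' \<bullet> (p - p') \<le> real_of_ereal (F p)"
    using assms by (auto simp: subdifferential_real_iff)
  then have "g \<bullet> (p' - p) + g' \<bullet> (p - p') \<le> 0" by linarith
  then show ?thesis by (simp add: algebra_simps inner_commute)
qed

text \<open>The given subgradient provides an affine minorant of \<^term>\<open>F\<close>, which bounds the proximal objective
from below after completing the square. In the application a saddle point provides it.\<close>

lemma proximal_inclusion_solvable:
  fixes F :: "'a::{real_inner,complete_space} \<Rightarrow> ereal"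
  assumes F: "proper_fun F" "convex_fun F" "lsc_fun F"
    and g0: "g0 \<in> subdifferential F x0" and r: "r > 0"
  shows "\<exists>p. \<exists>g\<in>subdifferential F p. u = p + r *\<^sub>R g"
proof -
  let ?f = "\<lambda>x. real_of_ereal (F x)"
  have conv: "convex_on (eff_dom F) ?f" using F by (intro convex_on_eff_dom)
  have ne: "eff_dom F \<noteq> {}" using F by (simp add: proper_fun_def)
  have "{z \<in> eff_dom F. ?f z \<le> c} = {z. F z \<le> ereal c}" for c
  proof (intro Collect_cong iffI conjI)
    fix z
    show "F z \<le> ereal c" if "z \<in> eff_dom F \<and> ?f z \<le> c"
      using that real_of_proper_fun[OF F(1), of z] by (metis ereal_less_eq(3))
    assume "F z \<le> ereal c"
    then show "z \<in> eff_dom F" by (auto simp: eff_dom_def)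
    then obtain a where "F z = ereal a" using proper_fun_real[OF F(1)] by blast
    with \<open>F z \<le> ereal c\<close> show "?f z \<le> c" by simp
  qed
  then have cl: "closed {z \<in> eff_dom F. ?f z \<le> c}" for c
    using closed_sublevel[OF F(3)] by simp
  have bdd: "?f x0 + g0 \<bullet> (u - x0) - r * (g0 \<bullet> g0) / 2 \<le> ?f z + (norm (z - u))\<^sup>2 / (2 * r)"
    if "z \<in> eff_dom F" for z
  proof -
    have "?f x0 + g0 \<bullet> (z - x0) \<le> ?f z"
      using g0 that by (simp add: subdifferential_real_iff[OF F(1)])
    moreover have "0 \<le> ((z - u) + r *\<^sub>R g0) \<bullet> ((z - u) + r *\<^sub>R g0) / (2 * r)"
      using r by simp
    moreover have "\<dots> = (norm (z - u))\<^sup>2 / (2 * r) + g0 \<bullet> (z - u) + r * (g0 \<bullet> g0) / 2"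
    proof -
      have "(w + r *\<^sub>R g0) \<bullet> (w + r *\<^sub>R g0) = w \<bullet> w + 2 * r * (g0 \<bullet> w) + r * r * (g0 \<bullet> g0)" for w
        by (simp add: algebra_simps inner_commute)
      from this[of "z - u"] show ?thesis
        using r by (simp add: power2_norm_eq_inner add_divide_distrib)
    qed
    moreover have "g0 \<bullet> (z - x0) = g0 \<bullet> (u - x0) + g0 \<bullet> (z - u)"
      by (simp add: inner_diff_right)
    ultimately show ?thesis by linarith
  qed
  obtain p where p: "p \<in> eff_dom F"
    and var: "\<And>z. z \<in> eff_dom F \<Longrightarrow> ?f p + (u - p) \<bullet> (z - p) / r \<le> ?f z"
    using proximal_variational_inequality[OF conv ne r cl bdd] by blast
  have "(1 / r) *\<^sub>R (u - p) \<in> subdifferential F p"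
    using p var by (simp add: subdifferential_real_iff[OF F(1)])
  moreover have "u = p + r *\<^sub>R ((1 / r) *\<^sub>R (u - p))" using r by simp
  ultimately show ?thesis by blast
qed

lemma resolvent_inclusion:
  fixes F :: "'a::{real_inner,complete_space} \<Rightarrow> ereal"
  assumes F: "proper_fun F" "convex_fun F" "lsc_fun F"
    and g0: "g0 \<in> subdifferential F x0" and r: "r > 0"
  shows "\<exists>g\<in>subdifferential F (resolvent r (subdifferential F) u).
    u = resolvent r (subdifferential F) u + r *\<^sub>R g"
  unfolding resolvent_def
proof (rule theI')
  show "\<exists>!p. \<exists>g\<in>subdifferential F p. u = p + r *\<^sub>R g"
  proof (rule ex_ex1I)
    show "\<exists>p. \<exists>g\<in>subdifferential F p. u = p + r *\<^sub>R g"
      by (rule proximal_inclusion_solvable[OF assms])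
    fix p p'
    assume "\<exists>g\<in>subdifferential F p. u = p + r *\<^sub>R g" "\<exists>g\<in>subdifferential F p'. u = p' + r *\<^sub>R g"
    then obtain g g' where g: "g \<in> subdifferential F p" "u = p + r *\<^sub>R g"
      and g': "g' \<in> subdifferential F p'" "u = p' + r *\<^sub>R g'" by blast
    have eq: "p - p' = - (r *\<^sub>R (g - g'))" using g(2) g'(2) by (simp add: algebra_simps)
    have "(p - p') \<bullet> (p - p') = - (r * ((p - p') \<bullet> (g - g')))"
      by (subst (2) eq) simp
    also have "\<dots> \<le> 0" using subdifferential_monotone[OF F(1) g(1) g'(1)] r by simp
    finally show "p = p'" by (metis inner_eq_zero_iff inner_ge_zero order_antisym right_minus_eq)
  qed
qed

lemma saddle_point_iff_subgradients:
  fixes K :: "'a::{real_inner,complete_space} \<Rightarrow> 'b::real_inner"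
  assumes K: "bounded_linear K" and F: "proper_fun F" and G: "proper_fun G"
  shows "saddle_point K F G xs ys \<longleftrightarrow>
    - adjoint K ys \<in> subdifferential F xs \<and> K xs \<in> subdifferential G ys"
proof (cases "xs \<in> eff_dom F \<and> ys \<in> eff_dom G")
  case True
  interpret bounded_linear K by (rule K)
  let ?f = "\<lambda>x. real_of_ereal (F x)" and ?g = "\<lambda>y. real_of_ereal (G y)"
  have L: "lagrangian K F G x y = ereal (K x \<bullet> y + ?f x - ?g y)"
    if "x \<in> eff_dom F" "y \<in> eff_dom G" for x y
    using proper_fun_real[OF F that(1)] proper_fun_real[OF G that(2)]
    by (force simp: lagrangian_def)
  have "saddle_point K F G xs ys \<longleftrightarrow> (\<forall>x\<in>eff_dom F. \<forall>y\<in>eff_dom G.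
      K xs \<bullet> y + ?f xs - ?g y \<le> K xs \<bullet> ys + ?f xs - ?g ys \<and>
      K xs \<bullet> ys + ?f xs - ?g ys \<le> K x \<bullet> ys + ?f x - ?g ys)"
    using True by (simp add: saddle_point_def L)
  also have "\<dots> \<longleftrightarrow> (\<forall>x\<in>eff_dom F. ?f xs + (- adjoint K ys) \<bullet> (x - xs) \<le> ?f x) \<and>
      (\<forall>y\<in>eff_dom G. ?g ys + K xs \<bullet> (y - ys) \<le> ?g y)"
  proof -
    have 1: "(K xs \<bullet> y + ?f xs - ?g y \<le> K xs \<bullet> ys + ?f xs - ?g ys) = (?g ys + K xs \<bullet> (y - ys) \<le> ?g y)" for y
      by (auto simp: inner_diff_right)
    have "(- adjoint K ys) \<bullet> (x - xs) = K xs \<bullet> ys - K x \<bullet> ys" for x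
      by (simp add: adjoint_inner[OF K] inner_diff_right inner_commute[of "adjoint K ys"])
    then have 2: "(K xs \<bullet> ys + ?f xs - ?g ys \<le> K x \<bullet> ys + ?f x - ?g ys)
        = (?f xs + (- adjoint K ys) \<bullet> (x - xs) \<le> ?f x)" for x
      by auto
    show ?thesis unfolding 1 2 using True by blast
  qed
  finally show ?thesis
    using True by (simp add: subdifferential_real_iff F G)
qed (auto simp: saddle_point_def subdifferential_def)

section \<open>Convergence to a saddle point\<close>

text \<open>The weights \<^term>\<open>1 / \<sigma>\<close> and \<^term>\<open>1 / \<tau>\<close> of the natural inner product on the product space are
absorbed by scaling the variables with \<^term>\<open>1 / sqrt \<sigma>\<close> and \<^term>\<open>1 / sqrt \<tau>\<close>, so that the plain inner
product of the product type can be used and both steps become resolvents with parameter one.\<close>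

theorem proposition2:
  fixes K :: "'a::{real_inner,complete_space} \<Rightarrow> 'b::{real_inner,complete_space}"
    and F :: "'a \<Rightarrow> ereal" and G :: "'b \<Rightarrow> ereal"
    and \<sigma> \<tau> :: real
    and x xbar b d :: "nat \<Rightarrow> 'a" and y ybar :: "nat \<Rightarrow> 'b"
  assumes "bounded_linear K"
    and "proper_fun F" "convex_fun F" "lsc_fun F"
    and "proper_fun G" "convex_fun G" "lsc_fun G"
    and "\<sigma> > 0" "\<tau> > 0"
    and "\<exists>xs ys. saddle_point K F G xs ys"
    and "DR_iteration K F G \<sigma> \<tau> x y xbar ybar b d"
  shows "\<exists>xs ys xbs ybs.
      weakly_converges_to (\<lambda>k. (x (Suc k), y (Suc k), xbar (Suc k), ybar (Suc k))) (xs, ys, xbs, ybs) \<and>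
      saddle_point K F G xs ys \<and>
      (xbs, ybs) = (xs - \<sigma> *\<^sub>R adjoint K ys, ys + \<tau> *\<^sub>R K xs)"
proof -
  note K = assms(1) and F = assms(2-4) and G = assms(5-7)
  interpret K: bounded_linear K by (rule K)
  interpret K': bounded_linear "adjoint K" by (rule bounded_linear_adjoint[OF K])
  note saddle = saddle_point_iff_subgradients[OF K F(1) G(1)]
  obtain xs ys where sub: "- adjoint K ys \<in> subdifferential F xs" "K xs \<in> subdifferential G ys"
    using assms(10) unfolding saddle by blast
  note resF = resolvent_inclusion[OF F sub(1) assms(8)]
    and resG = resolvent_inclusion[OF G sub(2) assms(9)]
  have x: "x (Suc k) = resolvent \<sigma> (subdifferential F) (xbar k)"
    and y: "y (Suc k) = resolvent \<tau> (subdifferential G) (ybar k)"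
    and b: "b (Suc k) = (2 *\<^sub>R x (Suc k) - xbar k) - \<sigma> *\<^sub>R adjoint K (2 *\<^sub>R y (Suc k) - ybar k)"
    and d: "d (Suc k) = inv (\<lambda>z. z + (\<sigma> * \<tau>) *\<^sub>R adjoint K (K z)) (b (Suc k))"
    and xbar: "xbar (Suc k) = xbar k - x (Suc k) + d (Suc k)"
    and ybar: "ybar (Suc k) = y (Suc k) + \<tau> *\<^sub>R K (d (Suc k))" for k
    using assms(11) unfolding DR_iteration_def by blast+
  have db: "d (Suc k) + (\<sigma> * \<tau>) *\<^sub>R adjoint K (K (d (Suc k))) = b (Suc k)" for k
    unfolding d using surj_f_inv_f[OF surj_id_plus_gram[OF K, of "\<sigma> * \<tau>"]] assms(8,9) by simp
  \<comment> \<open>The dual component of the second resolvent step, which the iteration leaves implicit.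
    The index is shifted because step \<open>Suc k\<close> reflects at the governing point \<open>k\<close>.\<close>
  define e where "e k = 2 *\<^sub>R y k - ybar (k - 1) + \<tau> *\<^sub>R K (d k)" for k
  define s t where "s = sqrt \<sigma>" and "t = sqrt \<tau>"
  have s: "s > 0" "s * s = \<sigma>" and t: "t > 0" "t * t = \<tau>"
    using assms(8,9) by (simp_all add: s_def t_def)
  have s': "\<sigma> / s = s" and t': "\<tau> / t = t"
    using s t by (simp_all add: field_simps)
  define M where "M = {(p, g). \<exists>g1\<in>subdifferential F (s *\<^sub>R fst p). \<exists>g2\<in>subdifferential G (t *\<^sub>R snd p).
    g = (s *\<^sub>R g1, t *\<^sub>R g2)}"
  have MI: "((p1, p2), (h1, h2)) \<in> M"
    if "g1 \<in> subdifferential F (s *\<^sub>R p1)" "g2 \<in> subdifferential G (t *\<^sub>R p2)"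
      "h1 = s *\<^sub>R g1" "h2 = t *\<^sub>R g2" for p1 p2 g1 g2 h1 h2
    using that by (auto simp: M_def)
  define A where "A p = ((s * t) *\<^sub>R adjoint K (snd p), - (s * t) *\<^sub>R K (fst p))" for p
  interpret DR: douglas_rachford M A
    "\<lambda>k. ((1 / s) *\<^sub>R x k, (1 / t) *\<^sub>R y k)" "\<lambda>k. ((1 / s) *\<^sub>R d k, (1 / t) *\<^sub>R e k)"
    "\<lambda>k. ((1 / s) *\<^sub>R xbar k, (1 / t) *\<^sub>R ybar k)"
  proof (rule douglas_rachford.intro)
    fix p g p' g' assume "(p, g) \<in> M" "(p', g') \<in> M"
    then obtain g1 g2 g1' g2' where
      g: "g1 \<in> subdifferential F (s *\<^sub>R fst p)" "g2 \<in> subdifferential G (t *\<^sub>R snd p)" "g = (s *\<^sub>R g1, t *\<^sub>R g2)"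
      and g': "g1' \<in> subdifferential F (s *\<^sub>R fst p')" "g2' \<in> subdifferential G (t *\<^sub>R snd p')"
        "g' = (s *\<^sub>R g1', t *\<^sub>R g2')"
      unfolding M_def by blast
    have "0 \<le> (s *\<^sub>R fst p - s *\<^sub>R fst p') \<bullet> (g1 - g1') + (t *\<^sub>R snd p - t *\<^sub>R snd p') \<bullet> (g2 - g2')"
      using g g' subdifferential_monotone[OF F(1)] subdifferential_monotone[OF G(1)]
      by (intro add_nonneg_nonneg) auto
    also have "\<dots> = (p - p') \<bullet> (g - g')"
      by (simp add: g g' inner_prod_def algebra_simps)
    finally show "0 \<le> (p - p') \<bullet> (g - g')" .
  next
    fix u :: "'a \<times> 'b"
    obtain p1 g1 where 1: "g1 \<in> subdifferential F p1" "s *\<^sub>R fst u = p1 + \<sigma> *\<^sub>R g1"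
      using resF by blast
    obtain p2 g2 where 2: "g2 \<in> subdifferential G p2" "t *\<^sub>R snd u = p2 + \<tau> *\<^sub>R g2"
      using resG by blast
    have "fst u - (1 / s) *\<^sub>R p1 = (1 / s) *\<^sub>R (s *\<^sub>R fst u - p1)"
      "snd u - (1 / t) *\<^sub>R p2 = (1 / t) *\<^sub>R (t *\<^sub>R snd u - p2)"
      using s t by (simp_all add: algebra_simps)
    then have "fst u - (1 / s) *\<^sub>R p1 = s *\<^sub>R g1" "snd u - (1 / t) *\<^sub>R p2 = t *\<^sub>R g2"
      using 1 2 s' t' by simp_all
    then have "(((1 / s) *\<^sub>R p1, (1 / t) *\<^sub>R p2), u - ((1 / s) *\<^sub>R p1, (1 / t) *\<^sub>R p2)) \<in> M"
      using MI[of g1 "(1 / s) *\<^sub>R p1" g2 "(1 / t) *\<^sub>R p2"] 1 2 s t by (cases u) simp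
    then show "\<exists>p. (p, u - p) \<in> M" by blast
  next
    show "bounded_linear A"
      unfolding A_def[abs_def]
      by (intro bounded_linear_Pair bounded_linear_const_scaleR
          bounded_linear_compose[OF K] bounded_linear_compose[OF bounded_linear_adjoint[OF K]]
          bounded_linear_fst bounded_linear_snd)
    show "A p \<bullet> p = 0" for p
      by (simp add: A_def inner_prod_def adjoint_inner[OF K] inner_commute[of "adjoint K _"])
  next
    fix k
    obtain g1 where 1: "g1 \<in> subdifferential F (x (Suc k))" "xbar k = x (Suc k) + \<sigma> *\<^sub>R g1"
      using resF x by metis
    obtain g2 where 2: "g2 \<in> subdifferential G (y (Suc k))" "ybar k = y (Suc k) + \<tau> *\<^sub>R g2"
      using resG y by metis
    show "(((1 / s) *\<^sub>R x (Suc k), (1 / t) *\<^sub>R y (Suc k)),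
        ((1 / s) *\<^sub>R xbar k, (1 / t) *\<^sub>R ybar k) - ((1 / s) *\<^sub>R x (Suc k), (1 / t) *\<^sub>R y (Suc k))) \<in> M"
      using MI[of g1 "(1 / s) *\<^sub>R x (Suc k)" g2 "(1 / t) *\<^sub>R y (Suc k)"] 1 2 s t s' t'
      by (simp add: scaleR_add_right)
    have "d (Suc k) + \<sigma> *\<^sub>R adjoint K (e (Suc k)) = 2 *\<^sub>R x (Suc k) - xbar k"
      using db[of k] unfolding b e_def by (simp add: K'.add K'.diff K'.scaleR algebra_simps)
    then have "(1 / s) *\<^sub>R (d (Suc k) + \<sigma> *\<^sub>R adjoint K (e (Suc k))) = (1 / s) *\<^sub>R (2 *\<^sub>R x (Suc k) - xbar k)"
      by (simp only:)
    then have "(1 / s) *\<^sub>R d (Suc k) + (s * t) *\<^sub>R adjoint K ((1 / t) *\<^sub>R e (Suc k))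
        = 2 *\<^sub>R ((1 / s) *\<^sub>R x (Suc k)) - (1 / s) *\<^sub>R xbar k"
      using s t s' by (simp add: K'.scaleR scaleR_add_right scaleR_diff_right)
    moreover have "(1 / t) *\<^sub>R e (Suc k) - (s * t) *\<^sub>R K ((1 / s) *\<^sub>R d (Suc k))
        = 2 *\<^sub>R ((1 / t) *\<^sub>R y (Suc k)) - (1 / t) *\<^sub>R ybar k"
      using s t t' by (simp add: e_def K.scaleR scaleR_add_right scaleR_diff_right mult.commute)
    ultimately show "((1 / s) *\<^sub>R d (Suc k), (1 / t) *\<^sub>R e (Suc k)) + A ((1 / s) *\<^sub>R d (Suc k), (1 / t) *\<^sub>R e (Suc k))
        = 2 *\<^sub>R ((1 / s) *\<^sub>R x (Suc k), (1 / t) *\<^sub>R y (Suc k)) - ((1 / s) *\<^sub>R xbar k, (1 / t) *\<^sub>R ybar k)"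
      by (simp add: A_def)
    have "ybar (Suc k) = ybar k - y (Suc k) + e (Suc k)"
      by (simp add: ybar e_def scaleR_2)
    then show "((1 / s) *\<^sub>R xbar (Suc k), (1 / t) *\<^sub>R ybar (Suc k))
        = ((1 / s) *\<^sub>R xbar k, (1 / t) *\<^sub>R ybar k) - ((1 / s) *\<^sub>R x (Suc k), (1 / t) *\<^sub>R y (Suc k))
          + ((1 / s) *\<^sub>R d (Suc k), (1 / t) *\<^sub>R e (Suc k))"
      by (simp add: xbar scaleR_add_right scaleR_diff_right)
  qed
  define p where "p = ((1 / s) *\<^sub>R xs, (1 / t) *\<^sub>R ys)"
  have "(p, (p - A p) - p) \<in> M"
    using MI[of "- adjoint K ys" "(1 / s) *\<^sub>R xs" "K xs" "(1 / t) *\<^sub>R ys"] sub s t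
    by (simp add: p_def A_def K.scaleR K'.scaleR)
  then have "(p, p - A p) \<in> DR.equilibria" by (simp add: DR.equilibria_def)
  then obtain p q where pq: "(p, q) \<in> DR.equilibria"
    and conv: "weakly_converges_to (\<lambda>k. (((1 / s) *\<^sub>R x (Suc k), (1 / t) *\<^sub>R y (Suc k)),
      ((1 / s) *\<^sub>R xbar (Suc k), (1 / t) *\<^sub>R ybar (Suc k)))) (p, q)"
    using DR.weak_convergence by blast
  define X Y where "X = s *\<^sub>R fst p" and "Y = t *\<^sub>R snd p"
  have q: "q = p - A p" using DR.equilibriaD(2)[OF pq] by simp
  obtain g1 g2 where g: "g1 \<in> subdifferential F X" "g2 \<in> subdifferential G Y"
    "q - p = (s *\<^sub>R g1, t *\<^sub>R g2)"
    using DR.equilibriaD(1)[OF pq] by (auto simp: M_def X_def Y_def)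
  have "s *\<^sub>R g1 = s *\<^sub>R (- adjoint K Y)" "t *\<^sub>R g2 = t *\<^sub>R K X"
    using g(3) by (simp_all add: q A_def X_def Y_def K.scaleR K'.scaleR mult.commute)
  then have "g1 = - adjoint K Y" "g2 = K X" using s t by (simp_all only: scaleR_cancel_left) auto
  with g have "saddle_point K F G X Y" by (simp add: saddle)
  \<comment> \<open>Undo the scaling; a bounded linear map preserves weak convergence.\<close>
  define T where "T = (\<lambda>v::('a \<times> 'b) \<times> ('a \<times> 'b).
    (s *\<^sub>R fst (fst v), t *\<^sub>R snd (fst v), s *\<^sub>R fst (snd v), t *\<^sub>R snd (snd v)))"
  have "bounded_linear T"
    unfolding T_def
    by (intro bounded_linear_Pair bounded_linear_const_scaleR
        bounded_linear_compose[OF bounded_linear_fst] bounded_linear_compose[OF bounded_linear_snd]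
        bounded_linear_fst bounded_linear_snd)
  from weakly_converges_to_bounded_linear_image[OF this conv]
  have "weakly_converges_to (\<lambda>k. (x (Suc k), y (Suc k), xbar (Suc k), ybar (Suc k)))
      (X, Y, s *\<^sub>R fst q, t *\<^sub>R snd q)"
    using s t by (simp add: T_def X_def Y_def)
  moreover have "s *\<^sub>R fst q = X - \<sigma> *\<^sub>R adjoint K Y" "t *\<^sub>R snd q = Y + \<tau> *\<^sub>R K X"
    using s t by (simp_all add: q A_def X_def Y_def K.scaleR K'.scaleR algebra_simps)
  ultimately show ?thesis using \<open>saddle_point K F G X Y\<close> by auto
qed

end
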